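(* Let $G$ be a graph on $n$ vertices with no isolated vertices that satisfies both of the following conditions: (a) for every edge $uv$ of $G$, $d_G(u)+d_G(v)\ge 4$; (b) no two vertices of degree $1$ in $G$ are at distance exactly $4$ in $G$. Then $\gamma_{\rm tg}(G)\le \frac{3}{4}n$.
   Context: For a graph $G$ without isolated vertices, a vertex $x$ totally dominates a vertex $y$ if $x$ and $y$ are adjacent. The total domination game on $G$ is played by two players, Dominator and Staller, who alternately choose vertices of $G$, Dominator choosing first. A vertex may be chosen only if it totally dominates at least one vertex that is not totally dominated by the previously chosen vertices. The game ends when the set of chosen vertices is a total dominating set of $G$, i.e. every vertex of $G$ has a neighbor among the chosen vertices. Dominator wants to minimize the number of chosen vertices and Staller wants to maximize it. The game total domination number $\gamma_{\rm tg}(G)$ is the number of vertices chosen when Dominator starts and both players play optimally. A leaf is a vertex of degree $1$. *)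

theory Defs
  imports Complex_Main
begin

definition simple_graph :: "'a set \<Rightarrow> ('a \<Rightarrow> 'a \<Rightarrow> bool) \<Rightarrow> bool" where
  "simple_graph V E \<longleftrightarrow> finite V \<and> (\<forall>u v. E u v \<longrightarrow> u \<in> V \<and> v \<in> V)
     \<and> (\<forall>u v. E u v \<longrightarrow> E v u) \<and> (\<forall>u. \<not> E u u)"

definition nbhd :: "'a set \<Rightarrow> ('a \<Rightarrow> 'a \<Rightarrow> bool) \<Rightarrow> 'a \<Rightarrow> 'a set" where
  "nbhd V E v = {u \<in> V. E v u}"

definition degree :: "'a set \<Rightarrow> ('a \<Rightarrow> 'a \<Rightarrow> bool) \<Rightarrow> 'a \<Rightarrow> nat" where
  "degree V E v = card (nbhd V E v)"

definition no_isolated :: "'a set \<Rightarrow> ('a \<Rightarrow> 'a \<Rightarrow> bool) \<Rightarrow> bool" where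
  "no_isolated V E \<longleftrightarrow> (\<forall>v \<in> V. \<exists>u. E v u)"

inductive walk :: "('a \<Rightarrow> 'a \<Rightarrow> bool) \<Rightarrow> 'a \<Rightarrow> 'a \<Rightarrow> nat \<Rightarrow> bool" for E where
  walk_nil: "walk E u u 0"
| walk_cons: "E u w \<Longrightarrow> walk E w v k \<Longrightarrow> walk E u v (Suc k)"

definition dist_eq :: "('a \<Rightarrow> 'a \<Rightarrow> bool) \<Rightarrow> 'a \<Rightarrow> 'a \<Rightarrow> nat \<Rightarrow> bool" where
  "dist_eq E u v k \<longleftrightarrow> walk E u v k \<and> (\<forall>j<k. \<not> walk E u v j)"

text \<open>Minimax value of the total domination game. State: the set D of
  vertices already totally dominated. A vertex v is a legal move iff it totally
  dominates some not yet dominated vertex. The boolean says whether it is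
  Dominator's turn (minimizer) or Staller's (maximizer). The first argument is
  fuel; since every move dominates at least one new vertex, fuel card V suffices.\<close>
definition legal_moves :: "'a set \<Rightarrow> ('a \<Rightarrow> 'a \<Rightarrow> bool) \<Rightarrow> 'a set \<Rightarrow> 'a set" where
  "legal_moves V E D = {v \<in> V. nbhd V E v - D \<noteq> {}}"

primrec tdg_val :: "'a set \<Rightarrow> ('a \<Rightarrow> 'a \<Rightarrow> bool) \<Rightarrow> nat \<Rightarrow> bool \<Rightarrow> 'a set \<Rightarrow> nat" where
  "tdg_val V E 0 t D = 0"
| "tdg_val V E (Suc f) t D =
     (if V \<subseteq> D then 0
      else if t then 1 + Min ((\<lambda>v. tdg_val V E f False (D \<union> nbhd V E v)) ` legal_moves V E D)
      else 1 + Max ((\<lambda>v. tdg_val V E f True (D \<union> nbhd V E v)) ` legal_moves V E D))"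

definition game_total_domination_number :: "'a set \<Rightarrow> ('a \<Rightarrow> 'a \<Rightarrow> bool) \<Rightarrow> nat" where
  "game_total_domination_number V E = tdg_val V E (card V) True {}"

end

theory Submission
  imports Defs
begin

text \<open>
  Give every vertex that is not yet totally dominated weight 2 and every playable vertex weight 1,
  so that the initial weight is at most \<open>3n\<close>; moves should lower the weight by 4 on average.
  A move dominating \<open>r\<close> new vertices lowers it by at least \<open>2r + 1\<close>. So every Staller move lowers it
  by at least 3, and Dominator lowers it by 5 as long as some vertex dominates two new vertices.
  When no such vertex is left, every move lowers the weight by 4, except that dominating a leaf may
  lower it by 3 only. To pay for those leaves, Dominator starts by playing supports (neighbours of
  leaves) that dominate at least three new vertices. By the distance condition distinct supports
  with a common neighbour are adjacent, hence the supports split into cliques with disjoint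
  neighbourhoods. The debt of a clique, added to the weight, is the number of its supports that
  still have an undominated leaf, capped by twice the number of dominated vertices in its
  neighbourhood. The debt is 0 at the start, and a Staller move raises it by at most \<open>2r\<close>. Playing a
  support raises it by at most the number of newly dominated supports, and this is paid for by their
  leaves, which are no longer playable. By the degree condition the cap no longer matters once every
  support dominates at most two new vertices.
\<close>

lemma walk_0_iff: "walk E u v 0 \<longleftrightarrow> u = v"
  by (auto elim: walk.cases intro: walk.intros)

lemma walk_Suc_iff: "walk E u v (Suc k) \<longleftrightarrow> (\<exists>w. E u w \<and> walk E w v k)"
  by (auto elim: walk.cases intro: walk.intros)

locale finite_simple_graph =
  fixes V :: "'a set" and E :: "'a \<Rightarrow> 'a \<Rightarrow> bool"
  assumes simple: "simple_graph V E"
begin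

abbreviation N where "N \<equiv> nbhd V E"
abbreviation deg where "deg \<equiv> degree V E"
abbreviation legal where "legal \<equiv> legal_moves V E"
abbreviation val where "val \<equiv> tdg_val V E"

lemma finite_V [simp]: "finite V"
  using simple by (simp add: simple_graph_def)

lemma E_sym: "E u v \<Longrightarrow> E v u"
  using simple by (simp add: simple_graph_def)

lemma E_irrefl [simp]: "\<not> E u u"
  using simple by (simp add: simple_graph_def)

lemma E_in_V: "E u v \<Longrightarrow> u \<in> V \<and> v \<in> V"
  using simple by (simp add: simple_graph_def)

lemma in_N [simp]: "u \<in> N v \<longleftrightarrow> E v u"
  using E_in_V by (auto simp: nbhd_def)

lemma N_subset: "N v \<subseteq> V"
  by (auto simp: nbhd_def)

lemma finite_N [simp]: "finite (N v)"
  by (rule finite_subset[OF N_subset finite_V])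

lemma legal_iff: "v \<in> legal D \<longleftrightarrow> N v - D \<noteq> {}"
  using E_in_V by (auto simp: legal_moves_def)

lemma legal_iff_card: "v \<in> legal D \<longleftrightarrow> card (N v - D) \<ge> 1"
  by (simp add: legal_iff Suc_le_eq card_gt_0_iff)

lemma legal_subset: "legal D \<subseteq> V"
  by (auto simp: legal_moves_def)

lemma finite_legal [simp]: "finite (legal D)"
  by (rule finite_subset[OF legal_subset finite_V])

definition weight :: "'a set \<Rightarrow> nat" where
  "weight D = 2 * card (V - D) + card (legal D)"

lemma weight_Un_le:
  assumes "A \<subseteq> V" "X \<subseteq> legal D - legal (D \<union> A)"
  shows "weight (D \<union> A) + 2 * card (A - D) + card X \<le> weight D"
proof -
  have "(V - D) \<inter> A = A - D" "V - D - A = V - (D \<union> A)"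
    using assms(1) by auto
  then have "card (V - D) = card (A - D) + card (V - (D \<union> A))"
    using card_Int_Diff[of "V - D" A] by simp
  moreover have "legal D \<inter> legal (D \<union> A) = legal (D \<union> A)"
    by (auto simp: legal_iff)
  then have "card (legal D) = card (legal (D \<union> A)) + card (legal D - legal (D \<union> A))"
    using card_Int_Diff[of "legal D" "legal (D \<union> A)"] by simp
  moreover have "card X \<le> card (legal D - legal (D \<union> A))"
    using assms(2) by (intro card_mono) auto
  ultimately show ?thesis by (simp add: weight_def)
qed

lemma weight_move_le:
  assumes "v \<in> legal D"
  shows "weight (D \<union> N v) + 2 * card (N v - D) + 1 \<le> weight D"
  using weight_Un_le[OF N_subset, of "{v}" D v] assms by (auto simp: legal_iff)

lemma weight_move_exclusive_le:
  assumes u: "u \<in> N v - D" and exclusive: "\<And>w. E u w \<Longrightarrow> N w - D = {u}"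
  shows "weight (D \<union> N v) + 2 + deg u \<le> weight D"
proof -
  have residual_eq: "N v - D = {u}"
    using exclusive u E_sym by auto
  moreover have "N u \<subseteq> legal D - legal (D \<union> N v)"
  proof
    fix w assume "w \<in> N u"
    then have "N w - D = {u}" using exclusive by simp
    moreover from this have "N w - (D \<union> N v) = {}"
      using u by (simp add: Diff_eq Int_assoc[symmetric])
    ultimately show "w \<in> legal D - legal (D \<union> N v)" by (simp add: legal_iff)
  qed
  from weight_Un_le[OF N_subset this] show ?thesis by (simp add: residual_eq degree_def)
qed

definition leaves :: "'a set" where
  "leaves = {u \<in> V. deg u = 1}"

definition supports :: "'a set" where
  "supports = {v. \<exists>u\<in>leaves. E v u}"

definition pending :: "'a set \<Rightarrow> 'a set" where
  "pending D = {v. \<exists>u\<in>leaves - D. E v u}"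

lemma finite_leaves [simp]: "finite leaves"
  by (simp add: leaves_def)

lemma N_of_leaf: "u \<in> leaves \<Longrightarrow> E u v \<Longrightarrow> N u = {v}"
  by (auto simp: leaves_def degree_def card_1_singleton_iff set_eq_iff)

lemma supports_subset: "supports \<subseteq> V"
  using E_in_V by (auto simp: supports_def)

lemma finite_supports [simp]: "finite supports"
  by (rule finite_subset[OF supports_subset finite_V])

lemma pending_subset_supports: "pending D \<subseteq> supports"
  by (auto simp: pending_def supports_def)

lemma finite_pending [simp]: "finite (pending D)"
  by (rule finite_subset[OF pending_subset_supports finite_supports])

lemma pending_antimono: "D \<subseteq> D' \<Longrightarrow> pending D' \<subseteq> pending D"
  by (auto simp: pending_def)

lemma not_pending_after_move: "v \<notin> pending (D \<union> N v)"
  by (auto simp: pending_def)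

lemma weight_plus_pending_move_le:
  assumes residual: "\<And>w. w \<in> V \<Longrightarrow> card (N w - D) \<le> 1" and v: "v \<in> legal D"
  shows "weight (D \<union> N v) + card (pending (D \<union> N v)) + 4 \<le> weight D + card (pending D)"
proof -
  obtain u where u: "u \<in> N v - D"
    using v unfolding legal_iff by blast
  then have u_in_V: "u \<in> V" using E_in_V by auto
  have pending_mono: "pending (D \<union> N v) \<subseteq> pending D"
    by (rule pending_antimono) simp
  show ?thesis
  proof (cases "u \<in> leaves")
    case True
    then have "v \<in> pending D"
      using u by (auto simp: pending_def)
    then have "card (pending (D \<union> N v)) < card (pending D)"
      using pending_mono not_pending_after_move by (intro psubset_card_mono) auto
    then show ?thesis
      using weight_move_le[OF v] v unfolding legal_iff_card by linarith
  next
    case False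
    have "N w - D = {u}" if "E u w" for w
      using residual[of w] E_in_V[OF that] E_sym[OF that] u card_le_Suc0_iff_eq[of "N w - D"]
      by auto
    from weight_move_exclusive_le[OF u this]
    have "weight (D \<union> N v) + 2 + deg u \<le> weight D" .
    moreover have "v \<in> N u"
      using u E_sym by simp
    then have "N u \<noteq> {}" by blast
    then have "deg u \<noteq> 0" by (simp add: degree_def)
    then have "deg u \<ge> 2"
      using False u_in_V by (auto simp: leaves_def)
    moreover have "card (pending (D \<union> N v)) \<le> card (pending D)"
      using pending_mono by (intro card_mono) auto
    ultimately show ?thesis by linarith
  qed
qed

lemma card_le_card_pendant_leaves:
  assumes "Y \<subseteq> supports"
  shows "card Y \<le> card {u \<in> leaves. N u \<subseteq> Y}"
proof -
  obtain leaf where leaf: "\<And>w. w \<in> supports \<Longrightarrow> leaf w \<in> leaves \<and> E w (leaf w)"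
    using bchoice[of supports "\<lambda>w u. u \<in> leaves \<and> E w u"] by (auto simp: supports_def)
  have N_leaf: "N (leaf w) = {w}" if "w \<in> Y" for w
    using that assms leaf N_of_leaf E_sym by blast
  then have "inj_on leaf Y"
    by (metis inj_onI singleton_inject)
  moreover have "leaf ` Y \<subseteq> {u \<in> leaves. N u \<subseteq> Y}"
    using assms leaf N_leaf by auto
  ultimately show ?thesis
    by (rule card_inj_on_le) simp
qed

lemma weight_move_nonleaf_le:
  assumes v: "v \<in> legal D" "v \<notin> leaves"
  shows "weight (D \<union> N v) + 2 * card (N v - D) + 1 + card (supports \<inter> N v - D) \<le> weight D"
proof -
  define Y where "Y = supports \<inter> N v - D"
  define X where "X = {u \<in> leaves. N u \<subseteq> Y}"
  have "insert v X \<subseteq> legal D - legal (D \<union> N v)"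
  proof -
    have "N u - D \<noteq> {} \<and> N u - (D \<union> N v) = {}" if "u \<in> X" for u
    proof -
      have "N u \<subseteq> N v" "N u \<inter> D = {}"
        using that by (auto simp: X_def Y_def)
      moreover have "N u \<noteq> {}"
        using that by (auto simp: X_def leaves_def degree_def)
      ultimately show ?thesis by blast
    qed
    then show ?thesis using v(1) by (auto simp: legal_iff)
  qed
  from weight_Un_le[OF N_subset this]
  have "weight (D \<union> N v) + 2 * card (N v - D) + card (insert v X) \<le> weight D" .
  moreover have "v \<notin> X" "finite X"
    using v(2) by (auto simp: X_def)
  then have "card (insert v X) = card X + 1" by simp
  moreover have "card Y \<le> card X"
    unfolding X_def by (rule card_le_card_pendant_leaves) (auto simp: Y_def)
  ultimately show ?thesis by (simp add: Y_def)
qed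

lemma leaves_dist_eq_4:
  assumes ends: "u \<in> leaves" "u' \<in> leaves"
    and path: "E u v" "E v x" "E x v'" "E v' u'"
    and neq: "v \<noteq> v'" and nonadj: "\<not> E v v'"
  shows "dist_eq E u u' 4"
proof -
  have from_u: "E u y \<longleftrightarrow> y = v" for y
    using N_of_leaf[OF ends(1) path(1)] by (metis in_N singleton_iff)
  have to_u': "E y u' \<longleftrightarrow> y = v'" for y
    using N_of_leaf[OF ends(2) E_sym[OF path(4)]] E_sym by (metis in_N singleton_iff)
  have "walk E u u' 4"
    using path by (auto simp: numeral_eq_Suc walk_0_iff walk_Suc_iff)
  moreover have "\<not> walk E u u' j" if "j < 4" for j
  proof -
    consider "j = 0" | "j = 1" | "j = 2" | "j = 3"
      using \<open>j < 4\<close> by linarith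
    then show ?thesis
    proof cases
      case 1
      then show ?thesis using from_u E_sym[OF path(4)] neq by (auto simp: walk_0_iff)
    next
      case 2
      then show ?thesis
        using E_sym[OF path(4)] nonadj by (auto simp: walk_0_iff walk_Suc_iff from_u)
    next
      case 3
      then show ?thesis
        using neq by (auto simp: numeral_eq_Suc walk_0_iff walk_Suc_iff from_u to_u')
    next
      case 4
      then show ?thesis
        using nonadj by (auto simp: numeral_eq_Suc walk_0_iff walk_Suc_iff from_u to_u')
    qed
  qed
  ultimately show ?thesis by (simp add: dist_eq_def)
qed

text \<open>
  How far a Staller move may stay below the average of 4: by 3 and 1 in the phases in which
  Dominator can lower the sum of weight and debt by 7 and by 5, and not at all afterwards.
\<close>

definition slack :: "'a set \<Rightarrow> nat" where
  "slack D =
     (if \<exists>v\<in>supports. card (N v - D) \<ge> 3 then 3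
      else if \<exists>v\<in>V. card (N v - D) \<ge> 2 then 1
      else 0)"

lemma slack_antimono:
  assumes "D \<subseteq> D'"
  shows "slack D' \<le> slack D"
proof -
  have "card (N v - D') \<le> card (N v - D)" for v
    using assms by (intro card_mono) auto
  then have "card (N v - D) \<ge> k" if "card (N v - D') \<ge> k" for v k
    using that le_trans by blast
  then show ?thesis
    using supports_subset by (fastforce simp: slack_def)
qed

lemma slack_cases:
  obtains (large_support) v where "slack D = 3" "v \<in> supports" "card (N v - D) \<ge> 3"
  | (large_residual) v where "slack D = 1" "card (N v - D) \<ge> 2"
      "\<And>w. w \<in> supports \<Longrightarrow> card (N w - D) \<le> 2"
  | (none) "slack D = 0"
proof (cases "\<exists>v\<in>supports. card (N v - D) \<ge> 3")
  case True
  then have "slack D = 3" by (simp add: slack_def)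
  with True show thesis using large_support by blast
next
  case no_large_support: False
  then have small_residual: "card (N w - D) \<le> 2" if "w \<in> supports" for w
    using that by force
  show thesis
  proof (cases "\<exists>v\<in>V. card (N v - D) \<ge> 2")
    case True
    with no_large_support have "slack D = 1" by (simp add: slack_def)
    with True show thesis using large_residual small_residual by blast
  next
    case False
    with no_large_support have "slack D = 0" by (simp add: slack_def)
    then show thesis by (rule none)
  qed
qed

end

locale isolate_free_graph = finite_simple_graph +
  assumes no_isolated: "no_isolated V E"
begin

lemma legal_nonempty: "\<not> V \<subseteq> D \<Longrightarrow> legal D \<noteq> {}"
  using no_isolated E_sym by (fastforce simp: no_isolated_def legal_iff)

lemma val_le_potential:
  fixes \<Phi> \<Psi> :: "'a set \<Rightarrow> nat"
  assumes dominator: "\<And>D. \<not> V \<subseteq> D \<Longrightarrow> \<exists>v\<in>legal D. \<Psi> (D \<union> N v) + c \<le> \<Phi> D"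
    and staller: "\<And>D v. v \<in> legal D \<Longrightarrow> \<Phi> (D \<union> N v) + c \<le> \<Psi> D"
  shows "c * val f True D \<le> \<Phi> D \<and> c * val f False D \<le> \<Psi> D"
proof (induction f arbitrary: D)
  case (Suc f)
  show ?case
  proof (cases "V \<subseteq> D")
    case False
    let ?after_dominator = "\<lambda>v. val f False (D \<union> N v)"
      and ?after_staller = "\<lambda>v. val f True (D \<union> N v)"
    obtain v where v: "v \<in> legal D" "\<Psi> (D \<union> N v) + c \<le> \<Phi> D"
      using dominator[OF False] by blast
    have "Min (?after_dominator ` legal D) \<le> ?after_dominator v"
      using v(1) by (intro Min_le) auto
    then have "val (Suc f) True D \<le> 1 + ?after_dominator v"
      using False by simp
    then have "c * val (Suc f) True D \<le> c * (1 + ?after_dominator v)"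
      by (rule mult_le_mono2)
    also have "\<dots> \<le> \<Phi> D"
      using Suc.IH[of "D \<union> N v"] v(2) by simp
    finally have "c * val (Suc f) True D \<le> \<Phi> D" .
    moreover have "Max (?after_staller ` legal D) \<in> ?after_staller ` legal D"
      using legal_nonempty[OF False] by (intro Max_in) auto
    then obtain w where w: "w \<in> legal D" "Max (?after_staller ` legal D) = ?after_staller w"
      by blast
    then have "c * val (Suc f) False D \<le> \<Psi> D"
      using Suc.IH[of "D \<union> N w"] staller[OF w(1)] False by simp
    ultimately show ?thesis ..
  qed simp
qed simp

end

locale leaf_separated_graph = finite_simple_graph +
  assumes leaf_dist: "u \<in> leaves \<Longrightarrow> v \<in> leaves \<Longrightarrow> \<not> dist_eq E u v 4"
begin

definition support_rel :: "('a \<times> 'a) set" where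
  "support_rel = {(v, w). v \<in> supports \<and> w \<in> supports \<and> (v = w \<or> E v w)}"

definition support_cliques :: "'a set set" where
  "support_cliques = supports // support_rel"

definition neighbourhood :: "'a set \<Rightarrow> 'a set" where
  "neighbourhood K = (\<Union>v\<in>K. N v)"

definition clique_debt :: "'a set \<Rightarrow> 'a set \<Rightarrow> nat" where
  "clique_debt D K = min (2 * card (neighbourhood K \<inter> D)) (card (pending D \<inter> K))"

definition debt :: "'a set \<Rightarrow> nat" where
  "debt D = (\<Sum>K\<in>support_cliques. clique_debt D K)"

lemma common_neighbour_support_rel:
  assumes "v \<in> supports" "w \<in> supports" "E v x" "E w x"
  shows "(v, w) \<in> support_rel"
proof -
  obtain u u' where "u \<in> leaves" "E u v" "u' \<in> leaves" "E w u'"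
    using assms(1,2) E_sym by (auto simp: supports_def)
  then have "v = w \<or> E v w"
    using leaves_dist_eq_4[of u u' v x w] leaf_dist[of u u'] assms(3) E_sym[OF assms(4)] by blast
  then show ?thesis using assms(1,2) by (simp add: support_rel_def)
qed

lemma equiv_support_rel: "equiv supports support_rel"
proof (rule equivI)
  show "trans support_rel"
  proof (rule transI)
    fix u v w assume uv: "(u, v) \<in> support_rel" and vw: "(v, w) \<in> support_rel"
    show "(u, w) \<in> support_rel"
    proof (cases "u = v \<or> v = w")
      case False
      then show ?thesis
        using uv vw E_sym
        by (intro common_neighbour_support_rel[of u w v]) (auto simp: support_rel_def)
    qed (use uv vw in auto)
  qed
qed (auto simp: support_rel_def refl_on_def sym_def intro: E_sym)

lemma support_clique_subset: "K \<in> support_cliques \<Longrightarrow> K \<subseteq> supports"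
  using Union_quotient[OF equiv_support_rel] by (auto simp: support_cliques_def)

lemma finite_support_clique: "K \<in> support_cliques \<Longrightarrow> finite K"
  by (rule finite_subset[OF support_clique_subset finite_supports])

lemma finite_support_cliques [simp]: "finite support_cliques"
  unfolding support_cliques_def
  by (rule finite_quotient) (auto simp: support_rel_def)

lemma support_clique_Diff_subset_N:
  assumes "K \<in> support_cliques" "v \<in> K"
  shows "K - {v} \<subseteq> N v"
proof
  fix w assume "w \<in> K - {v}"
  then show "w \<in> N v"
    using quotient_eq_iff[OF equiv_support_rel, of K K v w] assms
    by (auto simp: support_cliques_def support_rel_def)
qed

lemma finite_neighbourhood [simp]: "finite (neighbourhood K)"
  by (rule finite_subset[OF _ finite_V]) (auto simp: neighbourhood_def dest: E_in_V)

lemma N_subset_neighbourhood: "v \<in> K \<Longrightarrow> N v \<subseteq> neighbourhood K"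
  by (auto simp: neighbourhood_def)

lemma card_support_clique_Diff_le:
  assumes "K \<in> support_cliques" "v \<in> K"
  shows "card (K - {v}) \<le> card (neighbourhood K \<inter> D) + card (K - {v} - D)"
proof -
  have "(K - {v}) \<inter> D \<subseteq> neighbourhood K \<inter> D"
    using support_clique_Diff_subset_N[OF assms] N_subset_neighbourhood[OF assms(2)] by blast
  then have "card ((K - {v}) \<inter> D) \<le> card (neighbourhood K \<inter> D)"
    by (intro card_mono) auto
  then show ?thesis
    using card_Int_Diff[of "K - {v}" D] finite_support_clique[OF assms(1)]
    by (metis add_le_mono1 finite_Diff)
qed

lemma neighbourhoods_disjoint:
  assumes "K \<in> support_cliques" "K' \<in> support_cliques" "K \<noteq> K'"
  shows "neighbourhood K \<inter> neighbourhood K' = {}"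
proof (rule ccontr)
  assume "neighbourhood K \<inter> neighbourhood K' \<noteq> {}"
  then obtain v w x where vw: "v \<in> K" "w \<in> K'" and x: "E v x" "E w x"
    by (auto simp: neighbourhood_def)
  then have "(v, w) \<in> support_rel"
    using assms support_clique_subset by (intro common_neighbour_support_rel) auto
  then have "K = K'"
    using quotient_eqI[OF equiv_support_rel] assms vw unfolding support_cliques_def by blast
  then show False using assms(3) by contradiction
qed

lemma card_pending_eq_sum: "card (pending D) = (\<Sum>K\<in>support_cliques. card (pending D \<inter> K))"
proof -
  have "\<Union>support_cliques = supports"
    unfolding support_cliques_def by (rule Union_quotient[OF equiv_support_rel])
  then have "pending D = (\<Union>K\<in>support_cliques. pending D \<inter> K)"
    using pending_subset_supports by auto
  also have "card \<dots> = (\<Sum>K\<in>support_cliques. card (pending D \<inter> K))"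
    using quotient_disj[OF equiv_support_rel] unfolding support_cliques_def[symmetric]
    by (intro card_UN_disjoint) auto
  finally show ?thesis .
qed

lemma debt_le_pending: "debt D \<le> card (pending D)"
  unfolding debt_def card_pending_eq_sum clique_debt_def by (rule sum_mono) simp

lemma debt_empty: "debt {} = 0"
  by (simp add: debt_def clique_debt_def)

lemma clique_debt_Un_le:
  "clique_debt (D \<union> A) K \<le> clique_debt D K + 2 * card (neighbourhood K \<inter> (A - D))"
proof -
  have "neighbourhood K \<inter> (D \<union> A) = (neighbourhood K \<inter> D) \<union> (neighbourhood K \<inter> (A - D))"
    by auto
  then have "card (neighbourhood K \<inter> (D \<union> A))
      \<le> card (neighbourhood K \<inter> D) + card (neighbourhood K \<inter> (A - D))"
    by (metis card_Un_le)
  moreover have "card (pending (D \<union> A) \<inter> K) \<le> card (pending D \<inter> K)"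
    using pending_antimono[of D "D \<union> A"] by (intro card_mono) auto
  ultimately show ?thesis unfolding clique_debt_def by linarith
qed

lemma debt_Un_le:
  assumes "finite A"
  shows "debt (D \<union> A) \<le> debt D + 2 * card (A - D)"
proof -
  let ?new = "\<lambda>K. neighbourhood K \<inter> (A - D)"
  have "debt (D \<union> A) \<le> (\<Sum>K\<in>support_cliques. clique_debt D K + 2 * card (?new K))"
    unfolding debt_def by (rule sum_mono[OF clique_debt_Un_le])
  also have "\<dots> = debt D + 2 * (\<Sum>K\<in>support_cliques. card (?new K))"
    by (simp add: debt_def sum.distrib sum_distrib_left)
  also have "(\<Sum>K\<in>support_cliques. card (?new K)) = card (\<Union>K\<in>support_cliques. ?new K)"
    using neighbourhoods_disjoint by (intro card_UN_disjoint[symmetric]) auto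
  also have "\<dots> \<le> card (A - D)"
    using assms by (intro card_mono) auto
  finally show ?thesis by simp
qed

lemma clique_debt_support_move_le:
  assumes K: "K \<in> support_cliques" and v: "v \<in> K"
  shows "clique_debt (D \<union> N v) K \<le> clique_debt D K + card (supports \<inter> N v - D)"
proof -
  let ?still_pending = "pending (D \<union> N v) \<inter> K"
  have "?still_pending \<subseteq> K - {v}"
    using not_pending_after_move by auto
  then have "card ?still_pending \<le> card (K - {v})"
    using finite_support_clique[OF K] by (intro card_mono) auto
  also have "\<dots> \<le> card (neighbourhood K \<inter> D) + card (K - {v} - D)"
    by (rule card_support_clique_Diff_le[OF K v])
  also have "card (K - {v} - D) \<le> card (supports \<inter> N v - D)"
    using support_clique_Diff_subset_N[OF K v] support_clique_subset[OF K]
    by (intro card_mono) auto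
  finally have "card ?still_pending \<le> card (neighbourhood K \<inter> D) + card (supports \<inter> N v - D)"
    by simp
  moreover have "card ?still_pending \<le> card (pending D \<inter> K)"
    using pending_antimono[of D "D \<union> N v"] by (intro card_mono) auto
  ultimately show ?thesis unfolding clique_debt_def by linarith
qed

lemma debt_support_move_le:
  assumes v: "v \<in> supports"
  shows "debt (D \<union> N v) \<le> debt D + card (supports \<inter> N v - D)"
proof -
  obtain K where K: "K \<in> support_cliques" "v \<in> K"
    using v Union_quotient[OF equiv_support_rel] by (auto simp: support_cliques_def)
  have debt_outside_K: "clique_debt (D \<union> N v) K' \<le> clique_debt D K'"
    if "K' \<in> support_cliques - {K}" for K'
  proof -
    have "neighbourhood K' \<inter> neighbourhood K = {}"
      using that K by (intro neighbourhoods_disjoint) auto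
    then have "neighbourhood K' \<inter> (N v - D) = {}"
      using N_subset_neighbourhood[OF K(2)] by blast
    then show ?thesis using clique_debt_Un_le[of D "N v" K'] by simp
  qed
  have debt_split: "debt D' = clique_debt D' K + (\<Sum>K'\<in>support_cliques - {K}. clique_debt D' K')"
    for D'
    unfolding debt_def using K(1) by (intro sum.remove) auto
  have "(\<Sum>K'\<in>support_cliques - {K}. clique_debt (D \<union> N v) K')
      \<le> (\<Sum>K'\<in>support_cliques - {K}. clique_debt D K')"
    by (rule sum_mono[OF debt_outside_K])
  then show ?thesis
    using clique_debt_support_move_le[OF K, of D] debt_split[of D] debt_split[of "D \<union> N v"]
    by linarith
qed

definition potential :: "'a set \<Rightarrow> nat" where
  "potential D = weight D + debt D"

lemma potential_empty_le: "potential {} \<le> 3 * card V"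
  using card_mono[OF finite_V legal_subset] by (simp add: potential_def weight_def debt_empty)

lemma potential_move_le:
  assumes "v \<in> legal D"
  shows "potential (D \<union> N v) + 1 \<le> potential D"
  using weight_move_le[OF assms] debt_Un_le[OF finite_N, of D v] by (simp add: potential_def)

lemma potential_support_move_le:
  assumes "v \<in> supports" "v \<in> legal D" "v \<notin> leaves"
  shows "potential (D \<union> N v) + 2 * card (N v - D) + 1 \<le> potential D"
  using weight_move_nonleaf_le[OF assms(2,3)] debt_support_move_le[OF assms(1), of D]
  by (simp add: potential_def)

end

locale heavy_edge_graph = leaf_separated_graph +
  assumes degree_sum: "E u v \<Longrightarrow> deg u + deg v \<ge> 4"
begin

lemma support_degree_ge_3: "v \<in> supports \<Longrightarrow> deg v \<ge> 3"
  using degree_sum by (fastforce simp: supports_def leaves_def)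

lemma support_not_leaf: "v \<in> supports \<Longrightarrow> v \<notin> leaves"
  using support_degree_ge_3 by (fastforce simp: leaves_def)

lemma support_dominated_neighbour:
  assumes v: "v \<in> supports" and residual: "card (N v - D) \<le> 2"
  shows "N v \<inter> D \<noteq> {}"
proof -
  have "card (N v) \<ge> 3"
    using support_degree_ge_3[OF v] by (simp add: degree_def)
  then have "\<not> N v \<subseteq> N v - D"
    using residual card_mono[of "N v - D" "N v"] by auto
  then show ?thesis by blast
qed

lemma card_undominated_clique_less:
  assumes K: "K \<in> support_cliques" and v: "v \<in> pending D" "v \<in> K"
  shows "card (K - {v} - D) < card (N v - D)"
proof -
  obtain u where u: "u \<in> leaves" "u \<notin> D" "E v u"
    using v(1) by (auto simp: pending_def)
  then have "u \<notin> K"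
    using support_not_leaf support_clique_subset[OF K] by blast
  then have "card (insert u (K - {v} - D)) = card (K - {v} - D) + 1"
    using finite_support_clique[OF K] by simp
  moreover have "insert u (K - {v} - D) \<subseteq> N v - D"
    using u support_clique_Diff_subset_N[OF K v(2)] by auto
  then have "card (insert u (K - {v} - D)) \<le> card (N v - D)"
    by (intro card_mono) auto
  ultimately show ?thesis by linarith
qed

lemma card_pending_clique_le:
  assumes K: "K \<in> support_cliques" and residual: "\<And>v. v \<in> K \<Longrightarrow> card (N v - D) \<le> 2"
  shows "card (pending D \<inter> K) \<le> 2 * card (neighbourhood K \<inter> D)"
proof (cases "pending D \<inter> K = {}")
  case False
  then obtain v where v: "v \<in> pending D" "v \<in> K" by blast
  let ?dominated = "neighbourhood K \<inter> D"
  have finite_K: "finite K" by (rule finite_support_clique[OF K])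
  have undominated: "card (K - {v} - D) \<le> 1"
    using card_undominated_clique_less[OF K v] residual[OF v(2)] by linarith
  then have card_K_le: "card K \<le> card ?dominated + 2"
    using card_support_clique_Diff_le[OF K v(2), of D] card.remove[OF finite_K v(2)] by linarith
  have dominated_neighbour: "N w \<inter> ?dominated \<noteq> {}" if w: "w \<in> K" for w
  proof -
    have "N w \<inter> D \<noteq> {}"
      using residual[OF w] support_clique_subset[OF K] w by (intro support_dominated_neighbour) auto
    then show ?thesis using N_subset_neighbourhood[OF w] by blast
  qed
  then have "?dominated \<noteq> {}" using v(2) by blast
  then have "card ?dominated \<ge> 1"
    by (simp add: Suc_le_eq card_gt_0_iff)
  moreover have "card ?dominated \<ge> 2" if "card K \<ge> 3"
  proof -
    have "(K - {v}) \<inter> D \<noteq> {}"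
      using that undominated finite_K v(2) by (auto simp: Diff_triv)
    then obtain w where w: "w \<in> K - {v}" "w \<in> D" by blast
    then obtain x where x: "x \<in> ?dominated" "x \<in> N w" using dominated_neighbour[of w] by blast
    have "w \<in> ?dominated"
      using w support_clique_Diff_subset_N[OF K v(2)] N_subset_neighbourhood[OF v(2)] by blast
    moreover have "w \<noteq> x" using x(2) by auto
    ultimately show ?thesis using x(1) card_mono[of ?dominated "{w, x}"] by simp
  qed
  moreover have "card (pending D \<inter> K) \<le> card K"
    using finite_K by (intro card_mono) auto
  ultimately show ?thesis using card_K_le by linarith
qed simp

lemma debt_eq_pending:
  assumes "\<And>v. v \<in> supports \<Longrightarrow> card (N v - D) \<le> 2"
  shows "debt D = card (pending D)"
  unfolding debt_def card_pending_eq_sum clique_debt_def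
  using assms support_clique_subset
  by (intro sum.cong min_absorb2 card_pending_clique_le) auto

lemma potential_move_small_supports_le:
  assumes "\<And>w. w \<in> supports \<Longrightarrow> card (N w - D) \<le> 2" and v: "v \<in> legal D"
  shows "potential (D \<union> N v) + 2 * card (N v - D) + 1 \<le> potential D"
proof -
  have "debt (D \<union> N v) \<le> card (pending (D \<union> N v))"
    by (rule debt_le_pending)
  also have "\<dots> \<le> card (pending D)"
    by (intro card_mono pending_antimono) auto
  also have "\<dots> = debt D"
    using assms(1) by (rule debt_eq_pending[symmetric])
  finally show ?thesis using weight_move_le[OF v] by (simp add: potential_def)
qed

lemma potential_move_no_slack_le:
  assumes "slack D = 0" and v: "v \<in> legal D"
  shows "potential (D \<union> N v) + 4 \<le> potential D"
proof -
  have residual: "card (N w - D) \<le> 1" if "w \<in> V" for w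
    using assms(1) that by (force simp: slack_def split: if_splits)
  then have "debt D = card (pending D)"
    using supports_subset by (intro debt_eq_pending) force
  then show ?thesis
    using weight_plus_pending_move_le[OF residual v] debt_le_pending[of "D \<union> N v"]
    by (simp add: potential_def)
qed

lemma potential_staller_move_le:
  assumes v: "v \<in> legal D"
  shows "potential (D \<union> N v) + 4 \<le> potential D + slack D"
proof (cases D rule: slack_cases)
  case large_support
  then show ?thesis using potential_move_le[OF v] by simp
next
  case large_residual
  then show ?thesis
    using potential_move_small_supports_le[of D v] v unfolding legal_iff_card by simp
next
  case none
  then show ?thesis using potential_move_no_slack_le[OF _ v] by simp
qed

lemma potential_dominator_move:
  assumes "legal D \<noteq> {}"
  shows "\<exists>v\<in>legal D. potential (D \<union> N v) + slack (D \<union> N v) + 4 \<le> potential D"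
proof -
  have slack_le: "slack (D \<union> N v) \<le> slack D" for v
    by (rule slack_antimono) simp
  show ?thesis
  proof (cases D rule: slack_cases)
    case (large_support v)
    then have "v \<in> legal D" by (simp add: legal_iff_card)
    then show ?thesis
      using potential_support_move_le[of v D] support_not_leaf large_support slack_le[of v]
      by (intro bexI[of _ v]) auto
  next
    case (large_residual v)
    then have "v \<in> legal D" by (simp add: legal_iff_card)
    then show ?thesis
      using potential_move_small_supports_le[of D v] large_residual slack_le[of v]
      by (intro bexI[of _ v]) auto
  next
    case none
    obtain v where "v \<in> legal D" using assms by blast
    then show ?thesis
      using potential_move_no_slack_le[OF none] none slack_le[of v] by (intro bexI[of _ v]) auto
  qed
qed

end

theorem theorem2:
  fixes V :: "'a set" and E :: "'a \<Rightarrow> 'a \<Rightarrow> bool"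
  assumes "simple_graph V E"
    and "no_isolated V E"
    and "\<forall>u v. E u v \<longrightarrow> degree V E u + degree V E v \<ge> 4"
    and "\<forall>u \<in> V. \<forall>v \<in> V. degree V E u = 1 \<and> degree V E v = 1 \<longrightarrow> \<not> dist_eq E u v 4"
  shows "real (game_total_domination_number V E) \<le> 3 / 4 * real (card V)"
proof -
  interpret isolate_free_graph V E
    using assms(1,2) by unfold_locales
  interpret heavy_edge_graph V E
    using assms(3,4) by unfold_locales (auto simp: leaves_def)
  have "4 * val (card V) True {} \<le> potential {}"
    using val_le_potential[of "\<lambda>D. potential D + slack D" 4 potential]
      legal_nonempty potential_dominator_move potential_staller_move_le by blast
  also have "\<dots> \<le> 3 * card V"
    by (rule potential_empty_le)
  finally have "4 * game_total_domination_number V E \<le> 3 * card V"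
    by (simp add: game_total_domination_number_def)
  then show ?thesis by simp
qed

end
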